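(* For $q>1$ and $|u|<1$, $$\sum_{n \geq 0} u^n q^{n^2} \left[ \sum_{r=0}^{2n+1} \frac{1}{|O^+(r,q)||O^+(2n+1-r,q)|} + \sum_{r=1}^{2n} \frac{1}{|O^-(r,q)||O^-(2n+1-r,q)|} \right] = \frac{1}{1-u} \frac{\prod_{i \geq 1} (1+u/q^{2i})^2}{\prod_{i \geq 1} (1-u^2/q^{2i})} .$$
   Context: Here $q$ is a real number, $u$ is a complex number, and $|O^{\pm}(r,q)|$ denote the following expressions (which for odd prime powers $q$ are orders of finite orthogonal groups): for $m\ge 0$, $|O^{+}(2m+1,q)|=|O^{-}(2m+1,q)|=2q^{m^2}\prod_{i=1}^m(q^{2i}-1)$ (so $|O^{\pm}(1,q)|=2$); for $m\ge 1$, $|O^{\pm}(2m,q)|=\frac{2q^{m^2-m}}{q^m\pm 1}\prod_{i=1}^m (q^{2i}-1)$; and by convention $|O^+(0,q)|=1$ and $1/|O^-(0,q)|=0$. Sums whose upper limit is less than their lower limit are empty (equal to $0$). *)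

theory Defs
  imports "HOL-Analysis.Analysis"
begin

text \<open>The expressions written $|O^{\pm}(r,q)|$, for an arbitrary real \<open>q\<close>. In the even-dimensional case
  the exponent \<open>m\<^sup>2 - m\<close> is a natural number subtraction that never truncates.\<close>

definition card_O_odd :: "nat \<Rightarrow> real \<Rightarrow> real" where
  "card_O_odd m q = 2 * q ^ (m\<^sup>2) * (\<Prod>i=1..m. (q ^ (2 * i) - 1))"

definition card_O_plus :: "nat \<Rightarrow> real \<Rightarrow> real" where
  "card_O_plus r q =
    (if r = 0 then 1
     else if odd r then card_O_odd (r div 2) q
     else (let m = r div 2 in 2 * q ^ (m\<^sup>2 - m) / (q ^ m + 1) * (\<Prod>i=1..m. (q ^ (2 * i) - 1))))"

text \<open>The value \<open>0\<close> at \<open>r = 0\<close> encodes the convention $1/|O^-(0,q)| = 0$, since \<open>1 / 0 = 0\<close> in HOL.\<close>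

definition card_O_minus :: "nat \<Rightarrow> real \<Rightarrow> real" where
  "card_O_minus r q =
    (if r = 0 then 0
     else if odd r then card_O_odd (r div 2) q
     else (let m = r div 2 in 2 * q ^ (m\<^sup>2 - m) / (q ^ m - 1) * (\<Prod>i=1..m. (q ^ (2 * i) - 1))))"

end

theory Submission
  imports Defs
begin

text \<open>Put \<open>Q = q\<^sup>2\<close>. In each product one of \<open>r\<close> and \<open>2 * n + 1 - r\<close> is odd, where the two types agree, so the
  plus and minus terms combine and the coefficient of \<open>u ^ n\<close> becomes
  \<open>c n = (\<Sum>a+b=n. Q ^ (a * b + b) / (P a * P b))\<close> with \<open>P a = (\<Prod>i=1..a. Q ^ i - 1)\<close>.
  Weighting the summands of \<open>c n\<close> by \<open>1 / Q ^ b\<close> gives an auxiliary sequence \<open>b n\<close> with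
  \<open>b (n+1) = c (n+1) - c n\<close> and \<open>b (n+2) - b n / Q = (c (n+2) + c (n+1)) / Q ^ (n+2)\<close>. Hence the
  generating function \<open>F\<close> of \<open>c\<close> satisfies
  \<open>(1 - u) * (1 - u\<^sup>2 / Q) * F u = (1 + u / Q) * F (u / Q)\<close>, and iterating this towards \<open>F 0 = 1\<close>
  yields the infinite product.\<close>

section \<open>Weighted sums over pairs with a + b = n\<close>

definition qfac :: "real \<Rightarrow> nat \<Rightarrow> real" where
  "qfac Q n = (\<Prod>i=1..n. (Q ^ i - 1))"

definition pair_term :: "real \<Rightarrow> nat \<Rightarrow> nat \<Rightarrow> real" where
  "pair_term Q a b = Q ^ (a * b + b) / (qfac Q a * qfac Q b)"

text \<open>The weight is a parameter so that relations between different sums reduce to pointwise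
  identities between weights on \<open>a + b = n\<close>.\<close>

definition wsum :: "real \<Rightarrow> (nat \<Rightarrow> nat \<Rightarrow> real) \<Rightarrow> nat \<Rightarrow> real" where
  "wsum Q w n = (\<Sum>a\<le>n. w a (n - a) * pair_term Q a (n - a))"

lemma qfac_0 [simp]: "qfac Q 0 = 1"
  by (simp add: qfac_def)

lemma qfac_Suc: "qfac Q (Suc n) = qfac Q n * (Q ^ Suc n - 1)"
  by (simp add: qfac_def)

lemma qfac_pos: "Q > 1 \<Longrightarrow> qfac Q n > 0"
  unfolding qfac_def by (intro prod_pos) (auto intro: one_less_power)

lemma pair_term_Suc_left:
  assumes "Q > 1"
  shows "(1 - 1 / Q ^ Suc a) * pair_term Q (Suc a) b = Q ^ b / Q ^ Suc a * pair_term Q a b"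
proof -
  have "Q ^ Suc a > 1" using assms by (intro one_less_power) auto
  moreover have "qfac Q a \<noteq> 0" "qfac Q b \<noteq> 0" using qfac_pos[OF assms] by (metis less_irrefl)+
  moreover have "Q \<noteq> 0" using assms by simp
  ultimately show ?thesis
    by (simp add: pair_term_def qfac_Suc power_add divide_simps del: power_Suc)
qed

lemma pair_term_Suc_right:
  assumes "Q > 1"
  shows "(1 - 1 / Q ^ Suc b) * pair_term Q a (Suc b) = Q ^ Suc a / Q ^ Suc b * pair_term Q a b"
proof -
  have "Q ^ Suc b > 1" using assms by (intro one_less_power) auto
  moreover have "qfac Q a \<noteq> 0" "qfac Q b \<noteq> 0" using qfac_pos[OF assms] by (metis less_irrefl)+
  moreover have "Q \<noteq> 0" using assms by simp
  moreover have "Q ^ (a * Suc b + Suc b) = Q ^ (a * b + b) * Q ^ Suc a"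
    by (simp flip: power_add add: algebra_simps)
  ultimately show ?thesis
    by (simp add: pair_term_def qfac_Suc divide_simps del: power_Suc)
qed

text \<open>The factor \<open>1 - 1 / Q ^ a\<close> kills the summand \<open>a = 0\<close>; in the
  others, \<open>a\<close> is a successor and \<open>pair_term_Suc_left\<close> absorbs the
  factor.\<close>

lemma wsum_Suc_left:
  assumes "Q > 1"
  shows "wsum Q (\<lambda>a b. w a b * (1 - 1 / Q ^ a)) (Suc n)
    = wsum Q (\<lambda>a b. w (Suc a) b * (Q ^ b / Q ^ Suc a)) n"
  unfolding wsum_def sum.atMost_Suc_shift
  by (simp add: mult.assoc pair_term_Suc_left[OF assms] del: power_Suc)

text \<open>Mirror image: the summand killed is the last one, where \<open>b = 0\<close>.\<close>

lemma wsum_Suc_right: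
  assumes "Q > 1"
  shows "wsum Q (\<lambda>a b. w a b * (1 - 1 / Q ^ b)) (Suc n)
    = wsum Q (\<lambda>a b. w a (Suc b) * (Q ^ Suc a / Q ^ Suc b)) n"
  unfolding wsum_def sum.atMost_Suc
  by (simp add: mult.assoc Suc_diff_le pair_term_Suc_right[OF assms] del: power_Suc)

lemma wsum_diff: "wsum Q (\<lambda>a b. v a b - w a b) n = wsum Q v n - wsum Q w n"
  by (simp add: wsum_def sum_subtractf algebra_simps)

lemma wsum_cmult: "wsum Q (\<lambda>a b. k * w a b) n = k * wsum Q w n"
  by (simp add: wsum_def sum_distrib_left mult.assoc)

lemma wsum_cong:
  assumes "\<And>a b. a + b = n \<Longrightarrow> v a b = w a b"
  shows "wsum Q v n = wsum Q w n"
  unfolding wsum_def using assms by (intro sum.cong) auto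

section \<open>The sequences c and b and their recurrences\<close>

definition c_seq :: "real \<Rightarrow> nat \<Rightarrow> real" where
  "c_seq Q = wsum Q (\<lambda>a b. 1)"

definition b_seq :: "real \<Rightarrow> nat \<Rightarrow> real" where
  "b_seq Q = wsum Q (\<lambda>a b. 1 / Q ^ b)"

lemma c_seq_0 [simp]: "c_seq Q 0 = 1" and b_seq_0 [simp]: "b_seq Q 0 = 1"
  by (simp_all add: c_seq_def b_seq_def wsum_def pair_term_def)

text \<open>On \<open>a + b = n\<close> the constant weight \<open>1 / Q ^ n\<close> is
  \<open>1 / Q ^ (a + b)\<close>, so subtracting it from \<open>1 / Q ^ b\<close> or
  \<open>1 / Q ^ a\<close> yields a factor to which a shift lemma applies.\<close>

lemma wsum_minus_c_seq:
  "wsum Q w n - c_seq Q n / Q ^ n = wsum Q (\<lambda>a b. w a b - 1 / Q ^ n) n"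
  using wsum_cmult[of Q "1 / Q ^ n" "\<lambda>a b. 1" n] by (simp add: wsum_diff c_seq_def)

lemma c_seq_minus_b_seq:
  assumes "Q > 1"
  shows "c_seq Q (Suc n) - b_seq Q (Suc n) = wsum Q (\<lambda>a b. Q ^ a / Q ^ b) n"
proof -
  have "c_seq Q (Suc n) - b_seq Q (Suc n) = wsum Q (\<lambda>a b. 1 * (1 - 1 / Q ^ b)) (Suc n)"
    by (simp add: wsum_diff c_seq_def b_seq_def)
  then show ?thesis
    unfolding wsum_Suc_right[OF assms] using assms by simp
qed

text \<open>The weight difference is \<open>Q ^ a / Q ^ b * (1 - 1 / Q ^ a)\<close>, and the left
  shift turns it into the constant weight 1.\<close>

lemma ratio_wsum_minus_b_seq:
  assumes "Q > 1"
  shows "wsum Q (\<lambda>a b. Q ^ a / Q ^ b) (Suc n) - b_seq Q (Suc n) = c_seq Q n"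
proof -
  have "wsum Q (\<lambda>a b. Q ^ a / Q ^ b) (Suc n) - b_seq Q (Suc n)
      = wsum Q (\<lambda>a b. Q ^ a / Q ^ b * (1 - 1 / Q ^ a)) (Suc n)"
    unfolding b_seq_def wsum_diff[symmetric] using assms
    by (intro wsum_cong) (simp add: field_simps)
  also have "\<dots> = c_seq Q n"
    unfolding wsum_Suc_left[OF assms] c_seq_def using assms by simp
  finally show ?thesis .
qed

text \<open>The sum with weight \<open>Q ^ a / Q ^ b\<close> links consecutive indices: at n+1 it
  equals both c(n+2) - b(n+2) and b(n+1) + c(n), and the latter is c(n+1) by induction.\<close>

lemma c_seq_Suc:
  assumes "Q > 1"
  shows "c_seq Q (Suc n) = c_seq Q n + b_seq Q (Suc n)"
proof (induction n)
  case 0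
  show ?case using c_seq_minus_b_seq[OF assms, of 0] by (simp add: wsum_def pair_term_def)
next
  case (Suc n)
  then show ?case
    using c_seq_minus_b_seq[OF assms, of "Suc n"] ratio_wsum_minus_b_seq[OF assms, of n] by simp
qed

lemma inverse_power_diff:
  fixes Q :: real
  assumes "b + a = n"
  shows "1 / Q ^ b - 1 / Q ^ n = 1 / Q ^ b * (1 - 1 / Q ^ a)"
  unfolding assms[symmetric] by (simp add: power_add right_diff_distrib)

text \<open>The weight difference is \<open>1 / Q ^ b * (1 - 1 / Q ^ a)\<close>; the left shift
  cancels \<open>Q ^ b\<close> and leaves \<open>1 / Q ^ Suc a\<close>.\<close>

lemma b_seq_minus_c_seq:
  assumes "Q > 1"
  shows "b_seq Q (Suc n) - c_seq Q (Suc n) / Q ^ Suc n = wsum Q (\<lambda>a b. 1 / Q ^ a) n / Q"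
proof -
  have "b_seq Q (Suc n) - c_seq Q (Suc n) / Q ^ Suc n
      = wsum Q (\<lambda>a b. 1 / Q ^ b * (1 - 1 / Q ^ a)) (Suc n)"
    unfolding b_seq_def wsum_minus_c_seq
    by (rule wsum_cong) (rule inverse_power_diff, simp only: add.commute)
  also have "\<dots> = wsum Q (\<lambda>a b. 1 / Q * (1 / Q ^ a)) n"
    unfolding wsum_Suc_left[OF assms] using assms by simp
  also have "\<dots> = wsum Q (\<lambda>a b. 1 / Q ^ a) n / Q"
    unfolding wsum_cmult by simp
  finally show ?thesis .
qed

lemma left_wsum_minus_c_seq:
  assumes "Q > 1"
  shows "wsum Q (\<lambda>a b. 1 / Q ^ a) (Suc n) - c_seq Q (Suc n) / Q ^ Suc n = b_seq Q n"
proof -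
  have "wsum Q (\<lambda>a b. 1 / Q ^ a) (Suc n) - c_seq Q (Suc n) / Q ^ Suc n
      = wsum Q (\<lambda>a b. 1 / Q ^ a * (1 - 1 / Q ^ b)) (Suc n)"
    unfolding wsum_minus_c_seq
    by (rule wsum_cong) (simp add: inverse_power_diff del: power_Suc)
  also have "\<dots> = b_seq Q n"
    unfolding wsum_Suc_right[OF assms] b_seq_def using assms by simp
  finally show ?thesis .
qed

lemma b_seq_1:
  assumes "Q > 1"
  shows "b_seq Q (Suc 0) = (c_seq Q (Suc 0) + 1) / Q"
  using b_seq_minus_c_seq[OF assms, of 0] by (simp add: wsum_def pair_term_def add_divide_distrib)

text \<open>The sum with weight \<open>1 / Q ^ a\<close> at index n+1 is eliminated between
  \<open>b_seq_minus_c_seq\<close> and \<open>left_wsum_minus_c_seq\<close>.\<close>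

lemma b_seq_Suc_Suc:
  assumes "Q > 1"
  shows "b_seq Q (Suc (Suc n)) - b_seq Q n / Q
    = (c_seq Q (Suc (Suc n)) + c_seq Q (Suc n)) / Q ^ Suc (Suc n)"
proof -
  have "b_seq Q (Suc (Suc n)) = c_seq Q (Suc (Suc n)) / Q ^ Suc (Suc n)
      + (c_seq Q (Suc n) / Q ^ Suc n + b_seq Q n) / Q"
    using b_seq_minus_c_seq[OF assms, of "Suc n"] left_wsum_minus_c_seq[OF assms, of n]
    by (simp add: algebra_simps)
  then show ?thesis by (simp add: add_divide_distrib mult.commute)
qed

section \<open>Growth of the coefficients and convergence in the unit disc\<close>

lemma pair_term_bounded:
  assumes "Q > 1"
  obtains K where "\<And>a b. pair_term Q a b \<le> K"
proof -
  define h where "h n = (\<Prod>i<n. 1 - (1 / Q) ^ Suc i)" for n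
  have pos: "1 - (1 / Q) ^ Suc i > 0" for i
    using assms by (simp add: divide_simps one_less_power del: power_Suc)
  have hpos: "h n > 0" for n
    unfolding h_def by (intro prod_pos) (use pos in auto)
  have "summable (\<lambda>i. norm ((1 - (1 / Q) ^ Suc i) - 1))"
    using assms summable_mult[OF summable_geometric[of "1 / Q"], of "1 / Q"] by (simp add: abs_mult)
  then have conv: "convergent_prod (\<lambda>i. 1 - (1 / Q) ^ Suc i)"
    by (intro abs_convergent_prod_imp_convergent_prod) (simp add: abs_convergent_prod_conv_summable)
  have "h \<longlonglongrightarrow> (\<Prod>i. 1 - (1 / Q) ^ Suc i)"
    unfolding h_def LIMSEQ_lessThan_iff_atMost[where f = "prod (\<lambda>i. 1 - (1 / Q) ^ Suc i)"]
    by (rule convergent_prod_LIMSEQ[OF conv])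
  \<comment> \<open>A nonzero limit keeps \<open>h\<close> away from 0, which bounds its
    inverse.\<close>
  moreover have "(\<Prod>i. 1 - (1 / Q) ^ Suc i) \<noteq> 0"
    using pos by (intro prodinf_nonzero[OF conv]) (metis less_irrefl)
  ultimately have "Bseq (\<lambda>n. inverse (h n))"
    by (intro convergent_imp_Bseq convergentI[OF tendsto_inverse])
  then obtain K where K: "K > 0" "\<And>n. norm (inverse (h n)) \<le> K"
    by (auto elim: BseqE)
  \<comment> \<open>so \<open>pair_term Q a b\<close> is \<open>1 / (h a * h b)\<close> times a nonpositive power of \<open>Q\<close>\<close>
  have qfac: "qfac Q n = Q ^ (\<Sum>{..n}) * h n" for n
  proof (induction n)
    case (Suc n)
    have "Q ^ Suc n - 1 = Q ^ Suc n * (1 - (1 / Q) ^ Suc n)"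
      using assms by (simp add: right_diff_distrib power_divide del: power_Suc)
    moreover have "Q ^ \<Sum>{..Suc n} = Q ^ \<Sum>{..n} * Q ^ Suc n"
      by (simp only: sum.atMost_Suc power_add)
    ultimately show ?case
      using Suc by (simp only: qfac_Suc h_def prod.lessThan_Suc mult_ac)
  qed (simp add: h_def)
  have "a * b + b \<le> \<Sum>{..a} + \<Sum>{..b}" for a b :: nat
  proof -
    \<comment> \<open>Right side minus left side is (a - b)(a - b + 1), a product of consecutive
      integers and hence nonnegative.\<close>
    have "2 * (a * b + b) \<le> a * Suc a + b * Suc b"
    proof (cases "a \<le> b")
      case True
      then obtain d where "b = a + d" using le_Suc_ex by blast
      then show ?thesis by (cases d) (simp_all add: algebra_simps)
    next
      case False
      then obtain d where "a = b + d" by (metis le_Suc_ex nat_le_linear)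
      then show ?thesis by (simp add: algebra_simps)
    qed
    also have "\<dots> = 2 * (\<Sum>{..a} + \<Sum>{..b})"
      using gauss_sum_nat[of a] gauss_sum_nat[of b] by (simp add: atMost_atLeast0)
    finally show ?thesis by simp
  qed
  then have le: "Q ^ (a * b + b) \<le> Q ^ (\<Sum>{..a} + \<Sum>{..b})" for a b
    using assms by (intro power_increasing) auto
  have "pair_term Q a b \<le> K * K" for a b
  proof -
    have "pair_term Q a b = Q ^ (a * b + b) / Q ^ (\<Sum>{..a} + \<Sum>{..b}) * (inverse (h a) * inverse (h b))"
      by (simp add: pair_term_def qfac power_add field_simps)
    also have "\<dots> \<le> 1 * (K * K)"
      using le[of a b] K(1) K(2)[of a] K(2)[of b] hpos[of a] hpos[of b] assms
      by (intro mult_mono) (auto simp: less_imp_le)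
    finally show ?thesis by simp
  qed
  then show ?thesis using that by blast
qed

lemma c_seq_nonneg:
  assumes "Q > 1"
  shows "c_seq Q n \<ge> 0"
  unfolding c_seq_def wsum_def pair_term_def
  using assms qfac_pos[OF assms] by (auto intro!: sum_nonneg mult_nonneg_nonneg simp: less_imp_le)

text \<open>Each of the n+1 summands of \<open>c_seq Q n\<close> is at most \<open>K\<close>, so the
  differentiated geometric series, with coefficients n+1, is a majorant up to the factor
  \<open>K\<close>.\<close>

lemma summable_c_seq:
  fixes v :: complex
  assumes "Q > 1" "norm v < 1"
  shows "summable (\<lambda>n. of_real (c_seq Q n) * v ^ n)"
proof -
  obtain K where K: "\<And>a b. pair_term Q a b \<le> K"
    using pair_term_bounded[OF assms(1)] by blast
  have bound: "c_seq Q n \<le> of_nat (Suc n) * K" for n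
    unfolding c_seq_def wsum_def using sum_bounded_above[of "{..n}" _ K] K by simp
  have "summable (\<lambda>n. diffs (\<lambda>_. 1) n * norm v ^ n)"
    by (rule termdiff_converges[of _ 1]) (use assms in \<open>auto intro: summable_geometric\<close>)
  then have "summable (\<lambda>n. K * (real (Suc n) * norm v ^ n))"
    by (intro summable_mult) (simp add: diffs_def)
  then show ?thesis
  proof (rule summable_comparison_test'[where N = 0])
    fix n
    have "norm (of_real (c_seq Q n) * v ^ n) = c_seq Q n * norm v ^ n"
      using c_seq_nonneg[OF assms(1)] by (simp add: norm_mult norm_power)
    also have "\<dots> \<le> (real (Suc n) * K) * norm v ^ n"
      by (intro mult_right_mono bound) simp
    finally show "norm (of_real (c_seq Q n) * v ^ n) \<le> K * (real (Suc n) * norm v ^ n)"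
      by (simp only: mult_ac)
  qed
qed

section \<open>The functional equation of the generating function\<close>

definition c_gen :: "real \<Rightarrow> complex \<Rightarrow> complex" where
  "c_gen Q v = (\<Sum>n. of_real (c_seq Q n) * v ^ n)"

lemma norm_div_power_less_1:
  fixes u :: complex
  assumes "Q > 1" "norm u < 1"
  shows "norm (u / of_real Q ^ N) < 1"
proof -
  have "norm u < Q ^ N" using assms one_le_power[of Q N] by linarith
  then show ?thesis using assms by (simp add: norm_divide norm_power)
qed

text \<open>With \<open>B\<close>, \<open>C\<close>, \<open>G\<close> the series of b(n), c(n) and
  c(n) / Q^n, the recurrences become \<open>B = (1 - u) * C\<close> and
  \<open>(1 - u\<^sup>2 * x) * B = (1 + u * x) * G\<close>; then \<open>B\<close> is
  eliminated.\<close>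

lemma c_gen_functional_equation:
  assumes Q: "Q > 1" and u: "norm u < 1"
  shows "(1 - u) * (1 - u\<^sup>2 / of_real Q) * c_gen Q u = (1 + u / of_real Q) * c_gen Q (u / of_real Q)"
proof -
  define x :: complex where "x = 1 / of_real Q"
  let ?c = "\<lambda>n. complex_of_real (c_seq Q n)" and ?b = "\<lambda>n. complex_of_real (b_seq Q n)"
  let ?g = "\<lambda>n. ?c n * x ^ n"
  have "norm (u / of_real Q) < 1"
    using norm_div_power_less_1[OF assms, of 1] by simp
  from summable_c_seq[OF Q this] have sg: "summable (\<lambda>n. ?g n * u ^ n)"
    by (simp add: x_def power_divide mult_ac)
  note sc = summable_c_seq[OF Q u]
  note sc1 = powser_split_head(3)[OF sc] and sg1 = powser_split_head(3)[OF sg]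
  note sg2 = powser_split_head(3)[OF sg1]
  have c_Suc: "?c (Suc n) = ?c n + ?b (Suc n)" for n
    using c_seq_Suc[OF Q, of n] by simp
  \<comment> \<open>This is the shape of \<open>b2\<close> one index lower, with the absent b-term
    read as 0.\<close>
  have b1: "?b (Suc 0) = x * ?c (Suc 0) + x"
    using b_seq_1[OF Q] by (simp add: x_def add_divide_distrib)
  have b2: "?b (Suc (Suc n)) - x * ?b n = ?g (Suc (Suc n)) + x * ?g (Suc n)" for n
    using arg_cong[OF b_seq_Suc_Suc[OF Q, of n], of complex_of_real]
    by (simp add: x_def power_divide add_divide_distrib mult_ac)
  have sb1: "summable (\<lambda>n. ?b (Suc n) * u ^ n)"
    using summable_diff[OF sc1 sc] by (simp add: c_Suc algebra_simps)
  then have sb: "summable (\<lambda>n. ?b n * u ^ n)"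
    by (rule summable_powser_split_head[THEN iffD1])
  note sb2 = powser_split_head(3)[OF sb1]
  \<comment> \<open>The suffixes 1 and 2 mark series whose coefficients are shifted by one or two
    places.\<close>
  define C where "C = (\<Sum>n. ?c n * u ^ n)"
  define C1 where "C1 = (\<Sum>n. ?c (Suc n) * u ^ n)"
  define G where "G = (\<Sum>n. ?g n * u ^ n)"
  define G1 where "G1 = (\<Sum>n. ?g (Suc n) * u ^ n)"
  define G2 where "G2 = (\<Sum>n. ?g (Suc (Suc n)) * u ^ n)"
  define B where "B = (\<Sum>n. ?b n * u ^ n)"
  define B1 where "B1 = (\<Sum>n. ?b (Suc n) * u ^ n)"
  define B2 where "B2 = (\<Sum>n. ?b (Suc (Suc n)) * u ^ n)"
  have C: "C = 1 + C1 * u"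
    using powser_split_head(1)[OF sc] by (simp add: C_def C1_def)
  have G: "G = 1 + G1 * u"
    using powser_split_head(1)[OF sg] by (simp add: G_def G1_def)
  have G1: "G1 = ?c (Suc 0) * x + G2 * u"
    using powser_split_head(1)[OF sg1] by (simp add: G1_def G2_def)
  have B: "B = 1 + B1 * u"
    using powser_split_head(1)[OF sb] by (simp add: B_def B1_def)
  have B1: "B1 = x * ?c (Suc 0) + x + B2 * u"
    using powser_split_head(1)[OF sb1] by (simp add: B1_def B2_def b1)
  have "(\<lambda>n. (?c (Suc n) - ?c n) * u ^ n) sums (C1 - C)"
    using sums_diff[OF summable_sums[OF sc1] summable_sums[OF sc]]
    by (simp add: C1_def C_def left_diff_distrib)
  then have "C1 - C = B1"
    unfolding c_Suc B1_def by (simp add: sums_iff)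
  then have "B = 1 + C1 * u - u * C"
    using B by (simp add: algebra_simps flip: \<open>C1 - C = B1\<close>)
  then have BC: "B = (1 - u) * C"
    using C by (simp add: algebra_simps)
  have "(\<lambda>n. (?b (Suc (Suc n)) - x * ?b n) * u ^ n) sums (B2 - x * B)"
    using sums_diff[OF summable_sums[OF sb2] sums_mult[OF summable_sums[OF sb], of x]]
    by (simp only: B2_def B_def left_diff_distrib mult.assoc)
  moreover have "(\<lambda>n. (?g (Suc (Suc n)) + x * ?g (Suc n)) * u ^ n) sums (G2 + x * G1)"
    using sums_add[OF summable_sums[OF sg2] sums_mult[OF summable_sums[OF sg1], of x]]
    by (simp only: G2_def G1_def distrib_right mult.assoc)
  ultimately have B2: "B2 - x * B = G2 + x * G1"
    unfolding b2 by (rule sums_unique2)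
  have "B2 * u = x * B * u + G2 * u + x * (G1 * u)"
    using arg_cong[OF B2, of "\<lambda>z. z * u"] by (simp add: algebra_simps)
  also have "\<dots> = x * B * u + (G1 - ?c (Suc 0) * x) + x * (G - 1)"
    using G G1 by simp
  finally have "B1 = G1 + x * B * u + x * G"
    unfolding B1 by (simp add: algebra_simps)
  note B' = B[unfolded this]
  have "(1 - u\<^sup>2 * x) * B = B - u\<^sup>2 * x * B"
    by (simp add: left_diff_distrib)
  \<comment> \<open>Only the first \<open>B\<close> is expanded; the copy of \<open>B\<close> this
    creates cancels against the subtracted term.\<close>
  also have "\<dots> = 1 + (G1 + x * B * u + x * G) * u - u\<^sup>2 * x * B"
    by (rule arg_cong[OF B'])
  also have "\<dots> = (1 + u * x) * G"
    by (simp add: G power2_eq_square algebra_simps)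
  finally have "(1 - u\<^sup>2 * x) * B = (1 + u * x) * G" .
  moreover have "G = c_gen Q (u / of_real Q)"
    by (simp add: G_def c_gen_def x_def power_divide mult_ac)
  moreover have "C = c_gen Q u" by (simp add: C_def c_gen_def)
  ultimately show ?thesis using BC by (simp add: x_def mult_ac)
qed

section \<open>Iteration of the functional equation and the infinite product\<close>

lemma div_power_tendsto_0:
  fixes u :: complex
  assumes "Q > 1"
  shows "(\<lambda>N. u / of_real Q ^ N) \<longlonglongrightarrow> 0"
  using tendsto_mult_right_zero[OF LIMSEQ_power_zero[of "1 / complex_of_real Q"], of u] assms
  by (simp add: power_divide norm_divide)

lemma c_gen_tendsto:
  assumes "Q > 1"
  shows "(\<lambda>N. c_gen Q (u / of_real Q ^ N)) \<longlonglongrightarrow> 1"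
proof -
  \<comment> \<open>Summability at some nonzero point of the disc, here 1/2, gives continuity at
    0.\<close>
  have "summable (\<lambda>n. complex_of_real (c_seq Q n) * (1/2) ^ n)"
    using summable_c_seq[OF assms, of "1/2"] by simp
  then have "isCont (c_gen Q) 0"
    unfolding c_gen_def[abs_def] by (rule isCont_powser) simp
  from isCont_tendsto_compose[OF this div_power_tendsto_0[OF assms]]
  have "(\<lambda>N. c_gen Q (u / of_real Q ^ N)) \<longlonglongrightarrow> c_gen Q 0" .
  moreover have "c_gen Q 0 = 1" by (simp add: c_gen_def)
  ultimately show ?thesis by simp
qed

lemma one_minus_nonzero: "norm (z :: complex) < 1 \<Longrightarrow> 1 - z \<noteq> 0"
  by auto

text \<open>Iterating the functional equation produces only the odd factors of
  \<open>\<Prod>i. 1 - u\<^sup>2 / Q ^ i\<close>; the even ones split as \<open>(1 - u / Q ^ i) * (1 + u / Q ^ i)\<close>.\<close>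

lemma c_gen_iterate:
  assumes Q: "Q > 1" and u: "norm u < 1"
  shows "(1 - u) * (\<Prod>i<2*N. 1 - u\<^sup>2 / of_real Q ^ Suc i) * c_gen Q u
    = (1 - u / of_real Q ^ N) * (\<Prod>i<N. (1 + u / of_real Q ^ Suc i)\<^sup>2) * c_gen Q (u / of_real Q ^ N)"
proof (induction N)
  case (Suc N)
  define y where "y = u / of_real Q ^ N"
  have Q0: "complex_of_real Q \<noteq> 0" using Q by auto
  have odd: "u\<^sup>2 / of_real Q ^ Suc (2 * N) = y\<^sup>2 / of_real Q"
    by (simp add: y_def power_divide power_mult mult_ac power2_eq_square power_mult_distrib)
  have even: "u\<^sup>2 / of_real Q ^ Suc (Suc (2 * N)) = (y / of_real Q)\<^sup>2"
    using Q0 by (simp add: y_def power_divide power_mult power2_eq_square mult_ac power_mult_distrib)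
  have y: "u / of_real Q ^ Suc N = y / of_real Q"
    by (simp add: y_def mult_ac)
  have fe: "(1 - y) * (1 - y\<^sup>2 / of_real Q) * c_gen Q y = (1 + y / of_real Q) * c_gen Q (y / of_real Q)"
    unfolding y_def by (intro c_gen_functional_equation norm_div_power_less_1 Q u)
  have prod: "(\<Prod>i<2*Suc N. 1 - u\<^sup>2 / of_real Q ^ Suc i)
      = (\<Prod>i<2*N. 1 - u\<^sup>2 / of_real Q ^ Suc i) * (1 - y\<^sup>2 / of_real Q) * (1 - (y / of_real Q)\<^sup>2)"
    by (simp only: mult_Suc_right add_2_eq_Suc prod.lessThan_Suc odd even)
  define P where "P = (\<Prod>i<2*N. 1 - u\<^sup>2 / of_real Q ^ Suc i)"
  define R where "R = (\<Prod>i<N. (1 + u / of_real Q ^ Suc i)\<^sup>2)"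
  have IH: "(1 - u) * P * c_gen Q u = (1 - y) * R * c_gen Q y"
    using Suc by (simp only: P_def R_def y_def)
  \<comment> \<open>With \<open>z = y / Q\<close>, one \<open>1 + z\<close> comes from the
    functional equation and one from the even factor; the leftover \<open>1 - z\<close> is the
    leading factor for the next step.\<close>
  have regroup: "((1 + z) * g) * (R * (1 - z\<^sup>2)) = (1 - z) * (R * (1 + z)\<^sup>2) * g" for z g
    by (simp add: power2_eq_square algebra_simps)
  have "(1 - u) * (P * (1 - y\<^sup>2 / of_real Q) * (1 - (y / of_real Q)\<^sup>2)) * c_gen Q u
      = ((1 - u) * P * c_gen Q u) * ((1 - y\<^sup>2 / of_real Q) * (1 - (y / of_real Q)\<^sup>2))"
    by (simp only: mult_ac)
  also have "\<dots> = ((1 - y) * (1 - y\<^sup>2 / of_real Q) * c_gen Q y) * (R * (1 - (y / of_real Q)\<^sup>2))"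
    unfolding IH by (simp only: mult_ac)
  also have "\<dots> = (1 - y / of_real Q) * (R * (1 + y / of_real Q)\<^sup>2) * c_gen Q (y / of_real Q)"
    unfolding fe regroup ..
  finally show ?case
    unfolding prod prod.lessThan_Suc y P_def[symmetric] R_def[symmetric] .
qed simp

lemma convergent_prod_one_plus_geometric:
  fixes w :: complex
  assumes "Q > 1"
  shows "convergent_prod (\<lambda>i. 1 + w / of_real Q ^ Suc i)"
proof -
  have "summable (\<lambda>i. norm w / Q * (1 / Q) ^ i)"
    using assms by (intro summable_mult summable_geometric) simp
  then have "summable (\<lambda>i. norm ((1 + w / of_real Q ^ Suc i) - 1))"
    using assms by (simp add: norm_divide norm_mult norm_power power_divide)
  then show ?thesis
    by (intro abs_convergent_prod_imp_convergent_prod summable_imp_abs_convergent_prod)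
qed

lemma convergent_prod_one_minus_geometric:
  fixes w :: complex
  assumes "Q > 1"
  shows "convergent_prod (\<lambda>i. 1 - w / of_real Q ^ Suc i)"
  using convergent_prod_one_plus_geometric[OF assms, of "- w"] by simp

text \<open>Both sides of \<open>c_gen_iterate\<close> are taken to the limit in \<open>N\<close>;
  on the left the partial products run along the subsequence of even lengths.\<close>

lemma c_gen_eq_prodinf:
  assumes Q: "Q > 1" and u: "norm u < 1"
  shows "c_gen Q u = 1 / (1 - u) * ((\<Prod>i. (1 + u / of_real Q ^ Suc i)\<^sup>2) / (\<Prod>i. 1 - u\<^sup>2 / of_real Q ^ Suc i))"
    (is "_ = _ * (?R / ?P)")
proof -
  let ?p = "\<lambda>i. 1 - u\<^sup>2 / complex_of_real Q ^ Suc i" and ?r = "\<lambda>i. (1 + u / complex_of_real Q ^ Suc i)\<^sup>2"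
  have "norm (u\<^sup>2) < 1" using u by (simp add: norm_power power_less_one_iff)
  then have P0: "?P \<noteq> 0"
    by (intro prodinf_nonzero convergent_prod_one_minus_geometric Q one_minus_nonzero norm_div_power_less_1)
  have "(\<lambda>N. \<Prod>i<N. ?p i) \<longlonglongrightarrow> ?P"
    using convergent_prod_LIMSEQ[OF convergent_prod_one_minus_geometric[OF Q]]
    by (simp add: LIMSEQ_lessThan_iff_atMost)
  then have "(\<lambda>N. \<Prod>i<2*N. ?p i) \<longlonglongrightarrow> ?P"
    by (rule filterlim_compose[OF _ mult_nat_left_at_top]) simp
  then have lhs: "(\<lambda>N. (1 - u) * (\<Prod>i<2*N. ?p i) * c_gen Q u) \<longlonglongrightarrow> (1 - u) * ?P * c_gen Q u"
    by (intro tendsto_intros)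
  have R: "(\<lambda>N. \<Prod>i<N. ?r i) \<longlonglongrightarrow> ?R"
    using convergent_prod_LIMSEQ[OF convergent_prod_power[OF convergent_prod_one_plus_geometric[OF Q]]]
    by (simp add: LIMSEQ_lessThan_iff_atMost)
  have "(\<lambda>N. (1 - u / of_real Q ^ N) * (\<Prod>i<N. ?r i) * c_gen Q (u / of_real Q ^ N)) \<longlonglongrightarrow> (1 - 0) * ?R * 1"
    by (intro tendsto_intros R c_gen_tendsto div_power_tendsto_0 Q)
  with lhs have "(1 - u) * ?P * c_gen Q u = ?R"
    unfolding c_gen_iterate[OF Q u] by (auto dest: LIMSEQ_unique)
  then show ?thesis
    using P0 one_minus_nonzero[OF u] by (simp add: field_simps)
qed

section \<open>Reduction of the bracket to the coefficients c(n)\<close>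

lemma sum_even_odd:
  fixes g :: "nat \<Rightarrow> 'a::comm_monoid_add"
  shows "(\<Sum>r=0..2*n+1. g r) = (\<Sum>b\<le>n. g (2 * b)) + (\<Sum>a\<le>n. g (2 * a + 1))"
  by (induction n) (simp_all add: ac_simps)

lemma qfac_square: "qfac (q\<^sup>2) m = (\<Prod>i=1..m. q ^ (2 * i) - 1)"
  by (simp add: qfac_def power_mult)

lemma card_O_odd_eq: "card_O_odd m q = 2 * q ^ (m\<^sup>2) * qfac (q\<^sup>2) m"
  by (simp add: card_O_odd_def qfac_square)

text \<open>For positive \<open>b\<close> the two reciprocals have numerators
  \<open>q ^ b + 1\<close> and \<open>q ^ b - 1\<close> over a common denominator, so the constants
  cancel in the sum.\<close>

lemma inverse_card_O_even_sum:
  assumes "q > 1"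
  shows "1 / card_O_plus (2 * b) q + 1 / card_O_minus (2 * b) q = q ^ (2 * b) / (q ^ (b\<^sup>2) * qfac (q\<^sup>2) b)"
proof (cases "b = 0")
  case False
  define t X P where "t = q ^ b" and "X = q ^ (b\<^sup>2 - b)" and "P = qfac (q\<^sup>2) b"
  have "t > 1" using assms False by (simp add: t_def)
  have plus: "card_O_plus (2 * b) q = 2 * X / (t + 1) * P"
    and minus: "card_O_minus (2 * b) q = 2 * X / (t - 1) * P"
    using False by (simp_all add: card_O_plus_def card_O_minus_def t_def X_def P_def qfac_square)
  have "1 / card_O_plus (2 * b) q + 1 / card_O_minus (2 * b) q = (t + 1) / (2 * X * P) + (t - 1) / (2 * X * P)"
    by (simp add: plus minus)
  also have "\<dots> = t / (X * P)"
    unfolding add_divide_distrib[symmetric] by simp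
  also have "\<dots> = (t * t) / ((X * t) * P)"
    using \<open>t > 1\<close> by simp
  also have "t * t = q ^ (2 * b)" by (simp add: t_def mult_2 power_add)
  also have "X * t = q ^ (b\<^sup>2)"
    unfolding X_def t_def power_add[symmetric] by (simp add: power2_eq_square)
  finally show ?thesis by (simp add: P_def)
\<comment> \<open>For \<open>b = 0\<close> the minus reciprocal is \<open>1 / 0 = 0\<close>, so both
  sides are 1.\<close>
qed (simp add: card_O_plus_def card_O_minus_def)

lemma bracket_eq_c_seq:
  assumes q: "q > 1"
  shows "q ^ (n\<^sup>2) * ((\<Sum>r=0..2*n+1. 1 / (card_O_plus r q * card_O_plus (2*n+1-r) q))
         + (\<Sum>r=1..2*n. 1 / (card_O_minus r q * card_O_minus (2*n+1-r) q))) = c_seq (q\<^sup>2) n"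
proof -
  define O' where "O' a = 1 / card_O_odd a q" for a
  define E where "E b = 1 / card_O_plus (2 * b) q + 1 / card_O_minus (2 * b) q" for b
  let ?p = "\<lambda>r. 1 / (card_O_plus r q * card_O_plus (2*n+1-r) q)"
  let ?m = "\<lambda>r. 1 / (card_O_minus r q * card_O_minus (2*n+1-r) q)"
  \<comment> \<open>The two added end terms contain \<open>card_O_minus 0 q = 0\<close> in the
    denominator and so vanish; both sums now share one range.\<close>
  have "(\<Sum>r=1..2*n. ?m r) = (\<Sum>r=0..2*n+1. ?m r)"
  proof (rule sum.mono_neutral_left)
    show "\<forall>r\<in>{0..2*n+1} - {1..2*n}. ?m r = 0"
    proof
      fix r assume "r \<in> {0..2*n+1} - {1..2*n}"
      then have "r = 0 \<or> 2 * n + 1 - r = 0" by auto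
      then have "card_O_minus r q = 0 \<or> card_O_minus (2*n+1-r) q = 0"
        by (metis card_O_minus_def)
      then show "?m r = 0" by (simp only: mult_eq_0_iff divide_eq_0_iff simp_thms)
    qed
  qed auto
  then have "(\<Sum>r=0..2*n+1. ?p r) + (\<Sum>r=1..2*n. ?m r) = (\<Sum>r=0..2*n+1. ?p r + ?m r)"
    by (simp only: sum.distrib)
  also have "\<dots> = (\<Sum>b\<le>n. ?p (2 * b) + ?m (2 * b)) + (\<Sum>a\<le>n. ?p (2 * a + 1) + ?m (2 * a + 1))"
    by (rule sum_even_odd)
  also have "(\<Sum>b\<le>n. ?p (2 * b) + ?m (2 * b)) = (\<Sum>b\<le>n. O' (n - b) * E b)"
  proof (intro sum.cong refl)
    fix b assume "b \<in> {..n}"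
    then have "2 * n + 1 - 2 * b = 2 * (n - b) + 1" by auto
    then show "?p (2 * b) + ?m (2 * b) = O' (n - b) * E b"
      by (simp add: card_O_plus_def[of "Suc _"] card_O_minus_def[of "Suc _"] O'_def E_def
          add_divide_distrib mult.commute)
  qed
  also have "\<dots> = (\<Sum>a\<le>n. O' a * E (n - a))"
    by (rule sum.reindex_bij_witness[of _ "\<lambda>a. n - a" "\<lambda>a. n - a"]) auto
  also have "(\<Sum>a\<le>n. ?p (2 * a + 1) + ?m (2 * a + 1)) = (\<Sum>a\<le>n. O' a * E (n - a))"
  proof (intro sum.cong refl)
    fix a assume "a \<in> {..n}"
    then have "2 * n + 1 - (2 * a + 1) = 2 * (n - a)" by auto
    then show "?p (2 * a + 1) + ?m (2 * a + 1) = O' a * E (n - a)"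
      by (simp add: card_O_plus_def[of "Suc _"] card_O_minus_def[of "Suc _"] O'_def E_def
          add_divide_distrib mult.commute)
  qed
  \<comment> \<open>Even and odd \<open>r\<close> contribute equally; the resulting 2 cancels the 2
    in \<open>card_O_odd\<close>.\<close>
  finally have "q ^ (n\<^sup>2) * ((\<Sum>r=0..2*n+1. ?p r) + (\<Sum>r=1..2*n. ?m r))
      = (\<Sum>a\<le>n. q ^ (n\<^sup>2) * (2 * (O' a * E (n - a))))"
    by (simp add: sum_distrib_left)
  also have "\<dots> = (\<Sum>a\<le>n. pair_term (q\<^sup>2) a (n - a))"
  proof (intro sum.cong refl)
    fix a assume "a \<in> {..n}"
    then obtain b where n: "n = a + b" using le_Suc_ex by auto
    have "qfac (q\<^sup>2) a > 0" "qfac (q\<^sup>2) b > 0" using qfac_pos[of "q\<^sup>2"] q by simp_all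
    \<comment> \<open>The cross term 2ab of (a + b)^2 together with 2b gives the exponent of
      \<open>pair_term\<close> in base \<open>q\<^sup>2\<close>.\<close>
    moreover have "q ^ (n\<^sup>2) * q ^ (2 * b) = (q\<^sup>2) ^ (a * b + b) * q ^ (a\<^sup>2) * q ^ (b\<^sup>2)"
      unfolding n power_add[symmetric] power_mult[symmetric]
      by (simp add: power2_eq_square algebra_simps)
    ultimately show "q ^ (n\<^sup>2) * (2 * (O' a * E (n - a))) = pair_term (q\<^sup>2) a (n - a)"
      using q n
      by (simp add: O'_def E_def inverse_card_O_even_sum card_O_odd_eq pair_term_def)
  qed
  finally show ?thesis by (simp add: c_seq_def wsum_def)
qed

theorem theorem2p13:
  fixes q :: real and u :: complex
  assumes "q > 1" and "norm u < 1"
  shows "convergent_prod (\<lambda>i. (1 + u / of_real q ^ (2 * Suc i))\<^sup>2)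
    \<and> convergent_prod (\<lambda>i. 1 - u\<^sup>2 / of_real q ^ (2 * Suc i))
    \<and> (\<lambda>n. u ^ n * of_real (q ^ (n\<^sup>2) *
          ((\<Sum>r=0..2*n+1. 1 / (card_O_plus r q * card_O_plus (2*n+1-r) q))
         + (\<Sum>r=1..2*n. 1 / (card_O_minus r q * card_O_minus (2*n+1-r) q)))))
      sums
      (1 / (1 - u) * ((\<Prod>i. (1 + u / of_real q ^ (2 * Suc i))\<^sup>2)
                      / (\<Prod>i. 1 - u\<^sup>2 / of_real q ^ (2 * Suc i))))"
proof -
  have Q: "q\<^sup>2 > 1" using assms(1) by simp
  have eq: "complex_of_real q ^ (2 * k) = of_real (q\<^sup>2) ^ k" for k
    by (simp add: power_mult)
  have "(\<lambda>n. u ^ n * of_real (c_seq (q\<^sup>2) n)) sums c_gen (q\<^sup>2) u"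
    using summable_sums[OF summable_c_seq[OF Q assms(2)]] by (simp add: c_gen_def mult.commute)
  then show ?thesis
    unfolding bracket_eq_c_seq[OF assms(1)] eq c_gen_eq_prodinf[OF Q assms(2)]
    by (intro conjI convergent_prod_power convergent_prod_one_plus_geometric
        convergent_prod_one_minus_geometric Q)
qed

end
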